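(* Let $G$ be an inverse semigroup, let $A,B\subseteq G$ be finite subsets, let $t,s\in G$, and let $x=\varepsilon_A[t]$ and $y=\varepsilon_B[s]$ in $\mathbf{Pr}(G)$. Assuming that $t\in A$, one has $$xy=\varepsilon_{A\cup (tB)}[ts]=\varepsilon_{(tss^*t^*A)\cup (tB)}[ts].$$ If moreover both $x=\varepsilon_A[t]$ and $y=\varepsilon_B[s]$ are in normal form (in which case the requirement $t\in A$ is automatically satisfied), then the second expression $\varepsilon_{(tss^*t^*A)\cup (tB)}[ts]$ for $xy$ is in normal form.
   Context: For an inverse semigroup $G$, $s^*$ denotes the inverse of $s\in G$. $\mathbf{Pr}(G)$ denotes the universal semigroup with one generator $[s]$ for each $s\in G$ and, for all $s,t\in G$, the relations (i) $[s][t][t^*]=[st][t^*]$; (ii) $[s^*][s][t]=[s^*][st]$; (iii) $[s][s^*][s]=[s]$. For $s\in G$ put $\varepsilon_s=[s][s^*]$; these are idempotents that commute with each other, so for a finite set $A=\{s_1,\dots,s_n\}\subseteq G$ one may define $\varepsilon_A=\varepsilon_{s_1}\cdots\varepsilon_{s_n}$ (an empty product is simply omitted). For $t\in G$ and $B\subseteq G$, $tB=\{tb:b\in B\}$. An expression $\varepsilon_A[t]$ is in normal form if $A\subseteq G$ is a finite set with $t,tt^*\in A$ and $rr^*=tt^*$ for all $r\in A$. *)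

theory Defs
  imports Main
begin

class inverse_semigroup = semigroup_mult +
  fixes star :: "'a \<Rightarrow> 'a"
  assumes mult_star_mult: "s * star s * s = s"
    and star_mult_star: "star s * s * star s = star s"
    and star_unique: "s * t * s = s \<Longrightarrow> t * s * t = t \<Longrightarrow> t = star s"
begin

lemma star_star [simp]: "star (star s) = s"
  using star_unique[of "star s" s] mult_star_mult star_mult_star by simp

lemma star_idem:
  assumes "e * e = e"
  shows "star e = e"
  using star_unique[of e e] assms by simp

lemma idem_mult_idem:
  assumes e: "e * e = e" and f: "f * f = f"
  shows "(e * f) * (e * f) = e * f"
proof -
  define x where "x = star (e * f)"
  have ef': "e * (f * (x * (e * f))) = e * f"
    using mult_star_mult[of "e * f"] by (simp add: x_def mult.assoc)
  have xx: "x * (e * (f * x)) = x"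
    using star_mult_star[of "e * f"] by (simp add: x_def mult.assoc)
  have e': "e * (e * z) = e * z" and f': "f * (f * z) = f * z" for z
    using e f by (simp_all flip: mult.assoc)
  have fxe_inv: "f * x * e = star (e * f)"
  proof (rule star_unique)
    show "e * f * (f * x * e) * (e * f) = e * f"
      using ef' by (simp add: mult.assoc e' f')
    have "f * x * e * (e * f) * (f * x * e) = f * (x * (e * (f * x))) * e"
      by (simp add: mult.assoc e' f')
    then show "f * x * e * (e * f) * (f * x * e) = f * x * e"
      by (simp add: xx)
  qed
  then have x_eq: "x = f * x * e" by (simp add: x_def)
  have "x * x = f * x * e * (f * x * e)" using x_eq by simp
  also have "\<dots> = f * (x * (e * (f * x))) * e" by (simp add: mult.assoc)
  also have "\<dots> = x" using xx x_eq by simp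
  finally have "x * x = x" .
  then have "star x = x" by (rule star_idem)
  then have "e * f = x" by (simp add: x_def)
  with \<open>x * x = x\<close> show ?thesis by simp
qed

lemma idem_commute:
  assumes e: "e * e = e" and f: "f * f = f"
  shows "e * f = f * e"
proof -
  have e': "e * (e * z) = e * z" and f': "f * (f * z) = f * z" for z
    using e f by (simp_all flip: mult.assoc)
  have ef: "e * (f * (e * f)) = e * f" and fe: "f * (e * (f * e)) = f * e"
    using idem_mult_idem[OF e f] idem_mult_idem[OF f e] by (simp_all add: mult.assoc)
  have "f * e = star (e * f)"
    by (rule star_unique) (simp_all add: mult.assoc e' f' ef fe)
  also have "\<dots> = e * f"
    by (rule star_idem[OF idem_mult_idem[OF e f]])
  finally show ?thesis by simp
qed

lemma idem_mult_star: "(s * star s) * (s * star s) = s * star s"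
  by (metis mult.assoc mult_star_mult)

lemma idem_star_mult: "(star s * s) * (star s * s) = star s * s"
  by (metis mult.assoc mult_star_mult)

lemma star_mult: "star (s * t) = star t * star s"
proof -
  have c: "t * star t * (star s * s) = star s * s * (t * star t)"
    by (rule idem_commute[OF idem_mult_star idem_star_mult])
  have "s * t * (star t * star s) * (s * t) = s * (t * star t * (star s * s)) * t"
    by (simp add: mult.assoc)
  also have "\<dots> = (s * star s * s) * (t * star t * t)"
    unfolding c by (simp add: mult.assoc)
  finally have 1: "s * t * (star t * star s) * (s * t) = s * t"
    by (simp add: mult_star_mult)
  have "star t * star s * (s * t) * (star t * star s) =
      star t * (star s * s * (t * star t)) * star s"
    by (simp add: mult.assoc)
  also have "\<dots> = (star t * t * star t) * (star s * s * star s)"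
    unfolding c[symmetric] by (simp add: mult.assoc)
  finally have 2: "star t * star s * (s * t) * (star t * star s) = star t * star s"
    by (simp add: star_mult_star)
  from star_unique[OF 1 2] show ?thesis by simp
qed

end

text \<open>
  The semigroup \<open>Pr(G)\<close> is the quotient of the free magma on the symbols \<open>[s]\<close> by the least
  congruence that contains associativity and the relations (i)--(iii); no unit is adjoined.
\<close>

datatype 'a pr_term = Gen 'a | Mul "'a pr_term" "'a pr_term"

inductive pr_eq :: "'a::inverse_semigroup pr_term \<Rightarrow> 'a pr_term \<Rightarrow> bool" where
  refl: "pr_eq u u"
| sym: "pr_eq u v \<Longrightarrow> pr_eq v u"
| trans: "pr_eq u v \<Longrightarrow> pr_eq v w \<Longrightarrow> pr_eq u w"
| cong: "pr_eq u u' \<Longrightarrow> pr_eq v v' \<Longrightarrow> pr_eq (Mul u v) (Mul u' v')"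
| assoc: "pr_eq (Mul (Mul u v) w) (Mul u (Mul v w))"
| rel_i: "pr_eq (Mul (Mul (Gen s) (Gen t)) (Gen (star t))) (Mul (Gen (s * t)) (Gen (star t)))"
| rel_ii: "pr_eq (Mul (Mul (Gen (star s)) (Gen s)) (Gen t)) (Mul (Gen (star s)) (Gen (s * t)))"
| rel_iii: "pr_eq (Mul (Mul (Gen s) (Gen (star s))) (Gen s)) (Gen s)"

quotient_type (overloaded) 'a Pr = "'a::inverse_semigroup pr_term" / pr_eq
  by (rule equivpI) (auto simp: reflp_def symp_def transp_def intro: pr_eq.intros)

lift_definition gen :: "'a::inverse_semigroup \<Rightarrow> 'a Pr" is Gen .

instantiation Pr :: (inverse_semigroup) semigroup_mult
begin

lift_definition times_Pr :: "'a Pr \<Rightarrow> 'a Pr \<Rightarrow> 'a Pr" is Mul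
  by (rule pr_eq.cong)

instance
  by standard (transfer, rule pr_eq.assoc)

end

lemma gen_rel_i: "gen s * gen t * gen (star t) = gen (s * t) * gen (star t)"
  by transfer (rule pr_eq.rel_i)

lemma gen_rel_ii: "gen (star s) * gen s * gen t = gen (star s) * gen (s * t)"
  by transfer (rule pr_eq.rel_ii)

lemma gen_rel_iii: "gen s * gen (star s) * gen s = gen s"
  by transfer (rule pr_eq.rel_iii)

lemma Pr_induct [case_names gen mult]:
  assumes "\<And>s. P (gen s)" and "\<And>x y. P x \<Longrightarrow> P y \<Longrightarrow> P (x * y)"
  shows "P x"
  using assms
proof transfer
  fix P :: "'a pr_term \<Rightarrow> bool" and x :: "'a pr_term"
  assume "\<And>s. P (Gen s)" and "\<And>x y. P x \<Longrightarrow> P y \<Longrightarrow> P (Mul x y)"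
  then show "P x" by (induction x) auto
qed

lemma Pr_universal:
  fixes \<phi> :: "'a::inverse_semigroup \<Rightarrow> 'b::semigroup_mult"
  assumes i: "\<And>s t. \<phi> s * \<phi> t * \<phi> (star t) = \<phi> (s * t) * \<phi> (star t)"
    and ii: "\<And>s t. \<phi> (star s) * \<phi> s * \<phi> t = \<phi> (star s) * \<phi> (s * t)"
    and iii: "\<And>s. \<phi> s * \<phi> (star s) * \<phi> s = \<phi> s"
  shows "\<exists>!h. (\<forall>s. h (gen s) = \<phi> s) \<and> (\<forall>x y. h (x * y) = h x * h y)"
proof -
  define ev where "ev = rec_pr_term \<phi> (\<lambda>_ _. (*))"
  have ev [simp]: "ev (Gen s) = \<phi> s" "ev (Mul u v) = ev u * ev v" for s u v
    by (simp_all add: ev_def)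
  have resp: "ev u = ev v" if "pr_eq u v" for u v
    using that by induction (simp_all add: i ii iii flip: mult.assoc)
  define h where "h x = ev (rep_Pr x)" for x
  have h: "h (abs_Pr u) = ev u" for u
    unfolding h_def by (rule resp) (metis Quotient3_Pr Quotient3_abs_rep Pr.abs_eq_iff)
  have hg: "h (gen s) = \<phi> s" for s
    by (simp add: gen.abs_eq h)
  have hm: "h (x * y) = h x * h y" for x y
    by (induction x rule: Pr.abs_induct, induction y rule: Pr.abs_induct)
      (simp add: times_Pr.abs_eq h)
  show ?thesis
  proof (rule ex1I[of _ h])
    fix k assume k: "(\<forall>s. k (gen s) = \<phi> s) \<and> (\<forall>x y. k (x * y) = k x * k y)"
    show "k = h"
    proof
      fix x show "k x = h x"
        using k by (induction x rule: Pr_induct) (simp_all add: hg hm)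
    qed
  qed (simp add: hg hm)
qed

definition eps :: "'a::inverse_semigroup \<Rightarrow> 'a Pr" where
  "eps s = gen s * gen (star s)"

lemma eps_idem: "eps s * eps s = eps s"
  unfolding eps_def by (metis mult.assoc gen_rel_iii)

lemma gen_mult_eps: "gen s * eps t = eps (s * t) * gen s"
proof -
  let ?u = "s * t"
  have "?u * star ?u * s = s * ((t * star t) * (star s * s))"
    by (simp add: star_mult mult.assoc)
  also have "(t * star t) * (star s * s) = (star s * s) * (t * star t)"
    by (rule idem_commute[OF idem_mult_star idem_star_mult])
  also have "s * ((star s * s) * (t * star t)) = (s * star s * s) * t * star t"
    by (simp add: mult.assoc)
  finally have u: "?u * star ?u * s = ?u * star t"
    by (simp only: mult_star_mult)
  have "gen s * eps t = gen ?u * gen (star t)"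
    using gen_rel_i[of s t] by (simp add: eps_def mult.assoc)
  also have "\<dots> = gen ?u * (gen (star ?u) * gen ?u * gen (star t))"
    using gen_rel_iii[of ?u] by (simp add: mult.assoc[symmetric])
  also have "\<dots> = gen ?u * (gen (star ?u) * gen (?u * star ?u * s))"
    by (simp only: gen_rel_ii u)
  also have "\<dots> = gen ?u * (gen (star ?u) * gen ?u * gen (star ?u * s))"
    using gen_rel_ii[of ?u "star ?u * s"] by (simp add: mult.assoc)
  also have "\<dots> = gen ?u * gen (star ?u * s)"
    using gen_rel_iii[of ?u] by (simp add: mult.assoc[symmetric])
  also have "\<dots> = eps ?u * gen s"
    using gen_rel_ii[of "star ?u" s] by (simp add: eps_def)
  finally show ?thesis .
qed

lemma eps_mult_gen: "eps t * gen s = gen s * eps (star s * t)"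
proof -
  let ?v = "star t * s"
  have sv: "star (star s * t) = ?v" by (simp add: star_mult)
  have "s * (star ?v * ?v) = (s * star s) * (t * star t) * s"
    by (simp add: star_mult mult.assoc)
  also have "(s * star s) * (t * star t) = (t * star t) * (s * star s)"
    by (rule idem_commute[OF idem_mult_star idem_mult_star])
  also have "\<dots> * s = t * ?v"
    by (simp add: mult.assoc mult_star_mult[of s, unfolded mult.assoc])
  finally have u: "s * star ?v * ?v = t * ?v"
    by (simp add: mult.assoc)
  have "eps t * gen s = gen t * gen ?v"
    using gen_rel_ii[of "star t" s] by (simp add: eps_def)
  also have "\<dots> = gen t * gen ?v * gen (star ?v) * gen ?v"
    using gen_rel_iii[of ?v] by (simp add: mult.assoc)
  also have "\<dots> = gen (s * star ?v * ?v) * gen (star ?v) * gen ?v"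
    by (simp only: gen_rel_i u)
  also have "\<dots> = gen (s * star ?v) * gen ?v * gen (star ?v) * gen ?v"
    by (simp only: gen_rel_i)
  also have "\<dots> = gen (s * star ?v) * gen ?v"
    using gen_rel_iii[of ?v] by (simp add: mult.assoc)
  also have "\<dots> = gen s * gen (star ?v) * gen ?v"
    using gen_rel_i[of s "star ?v"] by simp
  also have "\<dots> = gen s * eps (star s * t)"
    by (simp add: eps_def sv star_mult mult.assoc)
  finally show ?thesis .
qed

lemma eps_commute: "eps s * eps t = eps t * eps s"
proof -
  have "eps s * eps t = gen s * (gen (star s) * eps t)"
    by (simp add: eps_def[of s] mult.assoc)
  also have "\<dots> = gen s * eps (star s * t) * gen (star s)"
    by (simp only: gen_mult_eps[of "star s" t] mult.assoc)
  also have "\<dots> = eps t * gen s * gen (star s)"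
    by (simp only: eps_mult_gen)
  finally show ?thesis
    by (simp add: eps_def[of s] mult.assoc)
qed

text \<open>
  \<open>eps_mult A x\<close> is \<open>\<epsilon>\<^sub>A x\<close>. Since \<open>Pr(G)\<close> need not have a unit, \<open>\<epsilon>\<^sub>A\<close> is given by its action on
  the factor to its right, which is the identity for \<open>A = {}\<close>. The fold is meaningful only for finite \<open>A\<close>.
\<close>

definition eps_mult :: "'a::inverse_semigroup set \<Rightarrow> 'a Pr \<Rightarrow> 'a Pr" where
  "eps_mult A x = Finite_Set.fold (\<lambda>s y. eps s * y) x A"

interpretation eps_fold: comp_fun_commute "\<lambda>s y. eps s * y"
  by standard (simp add: fun_eq_iff mult.assoc[symmetric] eps_commute)

lemma eps_mult_empty [simp]: "eps_mult {} x = x"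
  by (simp add: eps_mult_def)

lemma eps_mult_insert:
  assumes "finite A"
  shows "eps_mult (insert s A) x = eps s * eps_mult A x"
proof (cases "s \<in> A")
  case False
  with assms show ?thesis by (simp add: eps_mult_def)
next
  case True
  with assms have "eps_mult A x = eps s * eps_mult (A - {s}) x"
    by (simp add: eps_mult_def eps_fold.fold_rec)
  with True show ?thesis
    by (simp add: insert_absorb eps_idem mult.assoc[symmetric])
qed

lemma eps_mult_list: "eps_mult (set ss) x = foldr (\<lambda>s y. eps s * y) ss x"
  by (induction ss) (simp_all add: eps_mult_insert)

text \<open>Normality is a property of the expression \<open>\<epsilon>\<^sub>A[t]\<close>, that is of the pair \<open>(A, t)\<close>.\<close>

definition normal_form :: "'a::inverse_semigroup set \<Rightarrow> 'a \<Rightarrow> bool" where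
  "normal_form A t \<longleftrightarrow>
     finite A \<and> t \<in> A \<and> t * star t \<in> A \<and> (\<forall>r\<in>A. r * star r = t * star t)"

end

theory Submission
  imports Defs
begin

text \<open>
  Pushing \<open>[t]\<close> through \<open>\<epsilon>\<^sub>B\<close> turns it into \<open>\<epsilon>\<close> of \<open>tB\<close>, and a factor \<open>\<epsilon>\<^sub>t\<close> merges \<open>[t][s]\<close> into
  \<open>[ts]\<close>. In front of \<open>[u]\<close> the idempotent \<open>\<epsilon>\<^sub>a\<close> depends only on \<open>u\<^sup>*a\<close>, because it equals
  \<open>\<epsilon>\<close> of \<open>u\<^sup>*a\<close> once moved behind \<open>[u]\<close>; hence \<open>a\<close> may be replaced by \<open>uu\<^sup>*a\<close>.
\<close>

lemma eps_mult_assoc: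
  assumes "finite A"
  shows "eps_mult A x * y = eps_mult A (x * y)"
  using assms by (induction A) (simp_all add: eps_mult_insert mult.assoc)

lemma eps_mult_Un:
  assumes "finite A" and "finite B"
  shows "eps_mult (A \<union> B) x = eps_mult A (eps_mult B x)"
  using assms by (induction A) (simp_all add: eps_mult_insert)

text \<open>Distinct elements of \<open>B\<close> may have the same left multiple by
  \<open>t\<close>. The repeated factors then collapse by idempotence, which
  \<open>eps_mult_insert\<close> already takes into account.\<close>

lemma gen_mult_eps_mult:
  assumes "finite B"
  shows "gen t * eps_mult B x = eps_mult ((*) t ` B) (gen t * x)"
  using assms
proof (induction B)
  case (insert b B)
  have "gen t * eps_mult (insert b B) x = (gen t * eps b) * eps_mult B x"
    using insert.hyps by (simp add: eps_mult_insert mult.assoc)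
  also have "\<dots> = eps (t * b) * (gen t * eps_mult B x)"
    by (simp add: gen_mult_eps mult.assoc)
  finally show ?case
    using insert by (simp add: eps_mult_insert)
qed simp

text \<open>Idempotence lets a factor of \<open>eps_mult A\<close> be copied next to
  \<open>x\<close>. In the product formula this first creates the \<open>eps t\<close> needed for
  merging and afterwards removes it again.\<close>

lemma eps_mult_absorb_eps:
  assumes "finite A" and "t \<in> A"
  shows "eps_mult A x = eps_mult A (eps t * x)"
proof -
  have "A = A \<union> {t}" using assms(2) by auto
  then have "eps_mult A x = eps_mult (A \<union> {t}) x" by simp
  also have "\<dots> = eps_mult A (eps t * x)"
    using assms(1) by (simp only: eps_mult_Un eps_mult_insert finite.intros eps_mult_empty)
  finally show ?thesis .
qed

lemma eps_gen_mult_gen: "eps t * (gen t * gen s) = eps t * gen (t * s)"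
proof -
  have "eps t * (gen t * gen s) = gen t * gen (star t) * gen t * gen s"
    by (simp add: eps_def mult.assoc)
  also have "\<dots> = gen t * (gen (star t) * gen t * gen s)"
    by (simp add: mult.assoc)
  also have "\<dots> = gen t * (gen (star t) * gen (t * s))"
    by (simp only: gen_rel_ii)
  also have "\<dots> = eps t * gen (t * s)"
    by (simp add: eps_def mult.assoc)
  finally show ?thesis .
qed

lemma eps_mult_range_proj: "eps (u * star u * a) * gen u = eps a * gen u"
proof -
  have "star u * (u * star u * a) = star u * a"
    by (simp add: star_mult_star flip: mult.assoc)
  then show ?thesis by (simp add: eps_mult_gen)
qed

lemma eps_mult_range_proj_image:
  assumes "finite A"
  shows "eps_mult ((*) (u * star u) ` A) (gen u) = eps_mult A (gen u)"
  using assms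
proof (induction A)
  case (insert a A)
  \<comment> \<open>The replacement of \<open>a\<close> works only directly in front of
    \<open>gen u\<close>, so the new factor is moved past the others, with which it
    commutes.\<close>
  have pull: "eps c * eps_mult C (gen u) = eps_mult C (eps c * gen u)" if "finite C" for c C
    using that eps_mult_Un[of C "{c}" "gen u"] by (simp add: eps_mult_insert)
  let ?e = "(*) (u * star u)"
  have "eps_mult (?e ` insert a A) (gen u) = eps (?e a) * eps_mult A (gen u)"
    using insert by (simp add: eps_mult_insert)
  also have "\<dots> = eps a * eps_mult A (gen u)"
    using insert.hyps by (simp only: pull eps_mult_range_proj)
  finally show ?case
    using insert.hyps by (simp add: eps_mult_insert)
qed simp

lemma gen_product_eps_mult:
  assumes "finite A" and "finite B" and "t \<in> A"
  shows "eps_mult A (gen t) * eps_mult B (gen s) = eps_mult (A \<union> (*) t ` B) (gen (t * s))"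
proof -
  have "eps_mult A (gen t) * eps_mult B (gen s) =
      eps_mult (A \<union> (*) t ` B) (gen t * gen s)"
    using assms by (simp add: eps_mult_assoc gen_mult_eps_mult eps_mult_Un)
  also have "\<dots> = eps_mult (A \<union> (*) t ` B) (eps t * (gen t * gen s))"
    using assms by (intro eps_mult_absorb_eps) auto
  also have "\<dots> = eps_mult (A \<union> (*) t ` B) (gen (t * s))"
    unfolding eps_gen_mult_gen
    using assms by (intro eps_mult_absorb_eps[symmetric]) auto
  finally show ?thesis .
qed

text \<open>All elements of both sets have the range idempotent \<open>e\<close> of
  \<open>t * s\<close>: those of \<open>eA\<close> because \<open>e\<close> lies below
  \<open>t * star t\<close>, those of \<open>tB\<close> because
  \<open>t * (s * star s) * star t = e\<close>.\<close>

lemma normal_form_mult: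
  assumes A: "normal_form A t" and B: "normal_form B s"
  shows "normal_form ((*) (t * s * star (t * s)) ` A \<union> (*) t ` B) (t * s)"
proof -
  define e where "e = t * s * star (t * s)"
  have et: "e * (t * star t) = e"
    by (simp add: e_def star_mult mult.assoc star_mult_star[of t, unfolded mult.assoc])
  have ee: "e * e = e"
    unfolding e_def by (rule idem_mult_star)
  have e_range: "e * a * star (e * a) = e" if "a \<in> A" for a
  proof -
    have "e * a * star (e * a) = e * (a * star a) * e"
      by (simp add: star_mult mult.assoc star_idem[OF ee])
    also have "a * star a = t * star t"
      using A that unfolding normal_form_def by blast
    also have "e * (t * star t) * e = e"
      by (simp only: et ee)
    finally show ?thesis .
  qed
  have t_range: "t * b * star (t * b) = e" if "b \<in> B" for b
  proof -
    have "t * b * star (t * b) = t * (b * star b) * star t"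
      by (simp add: star_mult mult.assoc)
    also have "b * star b = s * star s"
      using B that unfolding normal_form_def by blast
    also have "t * (s * star s) * star t = e"
      by (simp add: e_def star_mult mult.assoc)
    finally show ?thesis .
  qed
  \<comment> \<open>The preimage is \<open>t * star t\<close>, which lies in \<open>A\<close> by
    normality and is absorbed by \<open>e\<close>.\<close>
  have "e \<in> (*) e ` A"
    using A et by (metis image_eqI normal_form_def)
  moreover have "t * s \<in> (*) t ` B" and "finite A" and "finite B"
    using A B unfolding normal_form_def by blast+
  ultimately show ?thesis
    unfolding normal_form_def e_def[symmetric] using e_range t_range by blast
qed

theorem proposition2p9:
  fixes A B :: "'a::inverse_semigroup set" and t s :: 'a and x y :: "'a Pr"
  assumes "finite A" and "finite B"
    and "x = eps_mult A (gen t)" and "y = eps_mult B (gen s)"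
  shows "(t \<in> A \<longrightarrow>
            x * y = eps_mult (A \<union> (\<lambda>b. t * b) ` B) (gen (t * s)) \<and>
            x * y = eps_mult ((\<lambda>a. t * s * star s * star t * a) ` A \<union> (\<lambda>b. t * b) ` B)
                      (gen (t * s))) \<and>
         (normal_form A t \<and> normal_form B s \<longrightarrow>
            t \<in> A \<and>
            normal_form ((\<lambda>a. t * s * star s * star t * a) ` A \<union> (\<lambda>b. t * b) ` B) (t * s))"
proof -
  have e: "t * s * star s * star t = t * s * star (t * s)"
    by (simp add: star_mult mult.assoc)
  let ?tB = "(*) t ` B"
  have "eps_mult (A \<union> ?tB) (gen (t * s)) =
      eps_mult ((*) (t * s * star (t * s)) ` A \<union> ?tB) (gen (t * s))"
    using assms(1,2)
    \<comment> \<open>Commuting the union puts the factors from \<open>tB\<close> on the left, so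
      that those from \<open>A\<close> act directly on \<open>gen (t * s)\<close>.\<close>
    by (simp only: Un_commute[of _ ?tB] eps_mult_Un finite_imageI eps_mult_range_proj_image)
  with gen_product_eps_mult[OF assms(1,2)] normal_form_mult show ?thesis
    unfolding e assms(3,4) by (metis normal_form_def)
qed

end
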